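(* Let $G$ be a $2$-connected chordal bipartite graph of order $n\ge 4$ and size $m$. Then $$m \ge \begin{cases} \frac{3}{2}n-\frac{3}{2} & \text{if } n \text{ is odd},\\ \frac{3}{2}n-2 & \text{if } n \text{ is even}.\end{cases}$$ Moreover, the bounds are tight: for every integer $n\ge 4$ there exists a $2$-connected chordal bipartite graph of order $n$ whose size equals the bound above for that $n$.
   Context: All graphs are finite and simple. The order of a graph is its number of vertices and the size is its number of edges. A graph is bipartite if its vertex set can be partitioned into two independent sets. A chord of a cycle $C$ is an edge not in $E(C)$ both of whose end-vertices lie on $C$. A bipartite graph is called chordal bipartite if every cycle of length at least six has a chord. A vertex cut of $G$ is a set $S\subseteq V(G)$ such that $G-S$ is disconnected. The connectivity $\kappa(G)$ is the minimum size of a vertex cut if $G$ is not complete, and $|V(G)|-1$ if $G$ is complete. $G$ is $k$-connected if $\kappa(G)\ge k$. *)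

theory Defs
  imports Complex_Main
begin

text \<open>A graph is given by its vertex set \<open>V\<close> and its set \<open>E\<close> of edges, an edge being
  the two-element set of its end-vertices. Its order is \<open>card V\<close> and its size is \<open>card E\<close>.\<close>

definition simple_graph :: "'a set \<Rightarrow> 'a set set \<Rightarrow> bool" where
  "simple_graph V E \<longleftrightarrow> finite V \<and> (\<forall>e\<in>E. e \<subseteq> V \<and> card e = 2)"

definition independent_set :: "'a set set \<Rightarrow> 'a set \<Rightarrow> bool" where
  "independent_set E A \<longleftrightarrow> (\<forall>u\<in>A. \<forall>v\<in>A. {u, v} \<notin> E)"

definition bipartite :: "'a set \<Rightarrow> 'a set set \<Rightarrow> bool" where
  "bipartite V E \<longleftrightarrow>
     (\<exists>A B. A \<union> B = V \<and> A \<inter> B = {} \<and> independent_set E A \<and> independent_set E B)"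

text \<open>A cycle is represented by the list of its vertices in cyclic order; the last vertex is
  adjacent to the first, which is not repeated. The length of the list is the length of the cycle.\<close>

definition cycle_edges :: "'a list \<Rightarrow> 'a set set" where
  "cycle_edges c = {{c ! i, c ! (Suc i mod length c)} | i. i < length c}"

definition is_cycle :: "'a set set \<Rightarrow> 'a list \<Rightarrow> bool" where
  "is_cycle E c \<longleftrightarrow> length c \<ge> 3 \<and> distinct c \<and> cycle_edges c \<subseteq> E"

definition is_chord :: "'a set set \<Rightarrow> 'a list \<Rightarrow> 'a set \<Rightarrow> bool" where
  "is_chord E c e \<longleftrightarrow> e \<in> E \<and> e \<notin> cycle_edges c \<and> e \<subseteq> set c"

definition chordal_bipartite :: "'a set \<Rightarrow> 'a set set \<Rightarrow> bool" where
  "chordal_bipartite V E \<longleftrightarrow>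
     bipartite V E \<and> (\<forall>c. is_cycle E c \<and> length c \<ge> 6 \<longrightarrow> (\<exists>e. is_chord E c e))"

definition graph_connected :: "'a set \<Rightarrow> 'a set set \<Rightarrow> bool" where
  "graph_connected V E \<longleftrightarrow> (\<forall>u\<in>V. \<forall>v\<in>V. (\<lambda>x y. {x, y} \<in> E)\<^sup>*\<^sup>* u v)"

definition vertex_cut :: "'a set \<Rightarrow> 'a set set \<Rightarrow> 'a set \<Rightarrow> bool" where
  "vertex_cut V E S \<longleftrightarrow> S \<subseteq> V \<and> \<not> graph_connected (V - S) {e \<in> E. e \<inter> S = {}}"

definition complete_graph :: "'a set \<Rightarrow> 'a set set \<Rightarrow> bool" where
  "complete_graph V E \<longleftrightarrow> (\<forall>u\<in>V. \<forall>v\<in>V. u \<noteq> v \<longrightarrow> {u, v} \<in> E)"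

text \<open>In a non-complete graph the complement of two non-adjacent vertices is a vertex cut, so
  the minimum below is attained.\<close>

definition connectivity :: "'a set \<Rightarrow> 'a set set \<Rightarrow> nat" where
  "connectivity V E =
     (if complete_graph V E then card V - 1
      else (LEAST k. \<exists>S. vertex_cut V E S \<and> card S = k))"

definition k_connected :: "nat \<Rightarrow> 'a set \<Rightarrow> 'a set set \<Rightarrow> bool" where
  "k_connected k V E \<longleftrightarrow> connectivity V E \<ge> k"

definition size_bound :: "nat \<Rightarrow> real" where
  "size_bound n = (if odd n then 3 / 2 * real n - 3 / 2 else 3 / 2 * real n - 2)"

end

(* Lower bound: grow a vertex set H, starting from a single edge, so that H induces no isolated
   vertex and e(H) >= 3/2 |H| - 2.  If H is not everything, an edge a-x leaving H, an H-neighbour b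
   of a, and a path from x to b avoiding a form a cycle that uses the H-edge a-b and leaves H.
   A chord always splits off a shorter such cycle, so a shortest one has length 4; adding its
   vertices to H adds one vertex with two edges or two vertices with three edges.

   Tightness: gluing 4-cycles along one fixed edge adds two vertices and three edges at a time,
   starting from that edge (even order) or from K_{2,3} (odd order). *)

theory Submission
  imports Defs
begin

section \<open>Cycles, paths and 2-connectedness\<close>

text \<open>Trades indices modulo the length for a path and a closing edge from
  \<open>last c\<close> to \<open>hd c\<close>. Lists can then be cut and extended by the rules for
  \<open>successively\<close>, and the closing edge can play a distinguished role.\<close>

lemma is_cycle_iff_successively:
  "is_cycle E c \<longleftrightarrow> length c \<ge> 3 \<and> distinct c \<and> successively (\<lambda>u v. {u, v} \<in> E) c
     \<and> {last c, hd c} \<in> E"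
proof (cases "length c \<ge> 3")
  case True
  then have ne: "c \<noteq> []" by auto
  have "cycle_edges c \<subseteq> E \<longleftrightarrow> (\<forall>i<length c. {c ! i, c ! (Suc i mod length c)} \<in> E)"
    unfolding cycle_edges_def by auto
  also have "\<dots> \<longleftrightarrow> (\<forall>i. Suc i < length c \<longrightarrow> {c ! i, c ! Suc i} \<in> E) \<and> {last c, hd c} \<in> E"
  proof (intro iffI conjI allI impI)
    assume *: "\<forall>i<length c. {c ! i, c ! (Suc i mod length c)} \<in> E"
    show "{c ! i, c ! Suc i} \<in> E" if "Suc i < length c" for i
      using *[rule_format, of i] that by simp
    show "{last c, hd c} \<in> E"
      using *[rule_format, of "length c - 1"] ne by (simp add: last_conv_nth hd_conv_nth)
  next
    fix i
    assume *: "(\<forall>i. Suc i < length c \<longrightarrow> {c ! i, c ! Suc i} \<in> E) \<and> {last c, hd c} \<in> E"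
      and i: "i < length c"
    show "{c ! i, c ! (Suc i mod length c)} \<in> E"
    proof (cases "Suc i = length c")
      case True
      then have "i = length c - 1" by simp
      with * ne True show ?thesis by (simp add: last_conv_nth hd_conv_nth)
    next
      case False
      with i * show ?thesis by simp
    qed
  qed
  finally show ?thesis
    using True unfolding is_cycle_def by (simp add: successively_conv_nth)
qed (simp add: is_cycle_def)

text \<open>Induction from the front: if the new start already lies on the path, everything before
  it is dropped. The bound on \<open>set p\<close> later shows that the path misses a deleted
  vertex.\<close>

lemma rtranclp_distinct_path:
  assumes "r\<^sup>*\<^sup>* u v"
  shows "\<exists>p. p \<noteq> [] \<and> hd p = u \<and> last p = v \<and> distinct p \<and> successively r p
    \<and> set p \<subseteq> insert u {w. \<exists>z. r z w}"
  using assms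
proof (induction rule: converse_rtranclp_induct)
  case base
  show ?case by (rule exI[of _ "[v]"]) simp
next
  case (step u w)
  then obtain p where p: "p \<noteq> []" "hd p = w" "last p = v" "distinct p" "successively r p"
      "set p \<subseteq> insert w {w. \<exists>z. r z w}" by blast
  show ?case
  proof (cases "u \<in> set p")
    case True
    then obtain ys zs where "p = ys @ u # zs" by (meson split_list)
    with p step(1) show ?thesis
      by (intro exI[of _ "u # zs"]) (auto simp: successively_append_iff)
  next
    case False
    with p step(1) show ?thesis
      by (intro exI[of _ "u # p"]) (auto simp: successively_Cons)
  qed
qed

text \<open>Vertex cuts of size 0 and 1 are exactly the failures of the two conditions on the right.
  For a complete graph the connectivity is \<open>card V - 1\<close>, which is at least 2 by the
  bound on the order.\<close>

lemma k_connected_2_iff: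
  assumes "simple_graph V E" "card V \<ge> 3"
  shows "k_connected 2 V E \<longleftrightarrow>
    graph_connected V E \<and> (\<forall>s\<in>V. graph_connected (V - {s}) {e \<in> E. s \<notin> e})"
proof (cases "complete_graph V E")
  case True
  have "graph_connected V E"
    using True unfolding graph_connected_def complete_graph_def
    by (metis (no_types, lifting) r_into_rtranclp rtranclp.rtrancl_refl)
  moreover have "graph_connected (V - {s}) {e \<in> E. s \<notin> e}" for s
    unfolding graph_connected_def
  proof (intro ballI)
    fix u v assume "u \<in> V - {s}" "v \<in> V - {s}"
    with True show "(\<lambda>x y. {x, y} \<in> {e \<in> E. s \<notin> e})\<^sup>*\<^sup>* u v"
      by (cases "u = v") (auto simp: complete_graph_def intro!: r_into_rtranclp)
  qed
  ultimately show ?thesis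
    using True assms by (simp add: k_connected_def connectivity_def)
next
  case False
  define P where "P k \<longleftrightarrow> (\<exists>S. vertex_cut V E S \<and> card S = k)" for k
  from False obtain u v where uv: "u \<in> V" "v \<in> V" "u \<noteq> v" "{u, v} \<notin> E"
    by (auto simp: complete_graph_def)
  \<comment> \<open>Only the non-adjacent \<open>u\<close> and \<open>v\<close> survive this
    deletion. So some \<open>k\<close> satisfies \<open>P\<close>, and \<open>LeastI\<close>
    applies.\<close>
  have "vertex_cut V E (V - {u, v})"
  proof -
    let ?F = "{e \<in> E. e \<inter> (V - {u, v}) = {}}"
    have "\<not> (\<lambda>x y. {x, y} \<in> ?F)\<^sup>*\<^sup>* u v"
    proof
      assume "(\<lambda>x y. {x, y} \<in> ?F)\<^sup>*\<^sup>* u v"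
      then obtain w where w: "{u, w} \<in> ?F"
        using uv(3) by (metis (no_types, lifting) converse_rtranclpE)
      then have "{u, w} \<subseteq> V" "card {u, w} = 2"
        using assms(1) by (auto simp: simple_graph_def)
      with w have "w = v" by auto
      with w uv show False by auto
    qed
    with uv show ?thesis unfolding vertex_cut_def graph_connected_def by blast
  qed
  then have "P (card (V - {u, v}))" by (auto simp: P_def)
  then have L: "P (LEAST k. P k)" by (rule LeastI)
  have fin: "finite V" using assms(1) by (simp add: simple_graph_def)
  have "2 \<le> (LEAST k. P k) \<longleftrightarrow> \<not> P 0 \<and> \<not> P 1"
  proof
    assume "2 \<le> (LEAST k. P k)"
    then show "\<not> P 0 \<and> \<not> P 1"
      using not_less_Least[of 0 P] not_less_Least[of 1 P] by linarith
  next
    assume *: "\<not> P 0 \<and> \<not> P 1"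
    have "k \<noteq> 0 \<and> k \<noteq> 1" if "P k" for k using that * by (intro conjI notI) simp_all
    from this[OF L] show "2 \<le> (LEAST k. P k)" by linarith
  qed
  moreover have "P 0 \<longleftrightarrow> \<not> graph_connected V E"
  proof -
    have "card S = 0 \<longleftrightarrow> S = {}" if "S \<subseteq> V" for S
      using finite_subset[OF that fin] by simp
    then have "P 0 \<longleftrightarrow> vertex_cut V E {}" unfolding P_def vertex_cut_def by blast
    then show ?thesis by (simp add: vertex_cut_def)
  qed
  moreover have "P 1 \<longleftrightarrow> (\<exists>s\<in>V. \<not> graph_connected (V - {s}) {e \<in> E. s \<notin> e})"
  proof -
    have "P 1 \<longleftrightarrow> (\<exists>s. vertex_cut V E {s})"
      unfolding P_def One_nat_def card_1_singleton_iff by blast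
    then show ?thesis by (auto simp: vertex_cut_def)
  qed
  ultimately show ?thesis
    using False by (simp add: k_connected_def connectivity_def P_def[symmetric])
qed

section \<open>Short cycles leaving a vertex set\<close>

text \<open>A path from \<open>x\<close> to \<open>b\<close> avoiding \<open>a\<close>, with
  \<open>a\<close> put in front, closes up along \<open>{a, b}\<close>, which thus becomes the
  closing edge of the cycle.\<close>

lemma cycle_through_adjacent_edges:
  assumes conn: "graph_connected (V - {a}) {e \<in> E. a \<notin> e}"
    and sub: "b \<in> V" "x \<in> V" and ne: "a \<noteq> b" "a \<noteq> x" "x \<noteq> b"
    and ax: "{a, x} \<in> E" and ab: "{a, b} \<in> E"
  obtains c where "is_cycle E c" "hd c = a" "last c = b" "x \<in> set c"
proof -
  have "(\<lambda>u v. {u, v} \<in> {e \<in> E. a \<notin> e})\<^sup>*\<^sup>* x b"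
    using conn sub ne unfolding graph_connected_def by blast
  from rtranclp_distinct_path[OF this] obtain p where
    p: "p \<noteq> []" "hd p = x" "last p = b" "distinct p"
      "successively (\<lambda>u v. {u, v} \<in> {e \<in> E. a \<notin> e}) p"
      "set p \<subseteq> insert x {w. \<exists>z. {z, w} \<in> {e \<in> E. a \<notin> e}}"
    by blast
  have "a \<notin> set p" using p(6) ne by auto
  moreover have "successively (\<lambda>u v. {u, v} \<in> E) p"
    using p(5) by (rule successively_mono) auto
  moreover have "length p \<ge> 2"
    using p(1-3) ne by (cases p; cases "tl p") auto
  ultimately have "is_cycle E (a # p)"
    using p ax ab by (auto simp: is_cycle_iff_successively successively_Cons insert_commute)
  moreover have "x \<in> set (a # p)" using p by auto
  ultimately show ?thesis using that[of "a # p"] p by simp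
qed

text \<open>The chord splits \<open>c\<close> so that \<open>c2\<close> keeps the closing edge of \<open>c\<close>, while the chord itself
  becomes the closing edge of \<open>c1\<close>.\<close>

lemma chord_splits_cycle:
  assumes c: "is_cycle E c" and chord: "is_chord E c e" and "card e = 2"
  obtains c1 c2 where "is_cycle E c1" "is_cycle E c2" "length c1 < length c" "length c2 < length c"
    "set c = set c1 \<union> set c2" "hd c2 = hd c" "last c2 = last c" "hd c1 \<in> set c2" "last c1 \<in> set c2"
proof -
  have len: "length c \<ge> 3" and dist: "distinct c"
    and succ: "\<And>i. Suc i < length c \<Longrightarrow> {c ! i, c ! Suc i} \<in> E" and cl: "{last c, hd c} \<in> E"
    using c by (auto simp: is_cycle_iff_successively successively_conv_nth)
  have ne: "c \<noteq> []" using len by auto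
  obtain u v where uv: "e = {u, v}" "u \<noteq> v" using \<open>card e = 2\<close> by (auto simp: card_2_iff)
  with chord have "u \<in> set c" "v \<in> set c" by (auto simp: is_chord_def)
  then obtain k l where "k < length c" "l < length c" "u = c ! k" "v = c ! l"
    by (auto simp: in_set_conv_nth)
  with uv obtain i j where ij: "i < j" "j < length c" "e = {c ! i, c ! j}"
    using that[of k l] that[of l k] by (cases k l rule: linorder_cases) (auto simp: insert_commute)
  have eE: "e \<in> E" and nc: "e \<notin> cycle_edges c" using chord by (auto simp: is_chord_def)
  have ce: "{c ! i, c ! (Suc i mod length c)} \<in> cycle_edges c" if "i < length c" for i
    using that unfolding cycle_edges_def by auto
  \<comment> \<open>The ends of the chord are not neighbours on \<open>c\<close>, not even around
    the end of the list. Here \<open>j1\<close> gives \<open>c1\<close> length at least 3 and makes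
    \<open>c2\<close> shorter than \<open>c\<close>; \<open>j2\<close> does the same with
    \<open>c1\<close> and \<open>c2\<close> exchanged.\<close>
  have j1: "j \<noteq> Suc i"
    using ce[of i] ij nc by auto
  have j2: "\<not> (i = 0 \<and> Suc j = length c)"
  proof
    assume h: "i = 0 \<and> Suc j = length c"
    with ce[of j] ij have "{c ! j, c ! 0} \<in> cycle_edges c" by simp
    with h ij nc show False by (simp add: insert_commute)
  qed
  \<comment> \<open>\<open>c1\<close> occupies the positions from \<open>i\<close> to
    \<open>j\<close>, and \<open>c2\<close> omits those strictly between, so both contain both ends
    of the chord.\<close>
  define c1 where "c1 = take (Suc (j - i)) (drop i c)"
  define c2 where "c2 = take (Suc i) c @ drop j c"
  have l1: "length c1 = Suc (j - i)" using ij by (simp add: c1_def)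
  have n1: "c1 ! k = c ! (i + k)" if "k \<le> j - i" for k
    using that ij by (simp add: c1_def)
  have h1: "hd c1 = c ! i" "last c1 = c ! j"
  proof -
    have "c1 \<noteq> []" using l1 by auto
    then show "hd c1 = c ! i" "last c1 = c ! j"
      using l1 n1[of 0] n1[of "j - i"] ij by (auto simp: hd_conv_nth last_conv_nth)
  qed
  have cyc1: "is_cycle E c1"
    unfolding is_cycle_iff_successively successively_conv_nth
    using l1 ij j1 dist h1 eE succ n1
    by (auto simp: insert_commute) (auto simp: c1_def)
  have h2: "hd c2 = hd c" "last c2 = last c"
    using ij ne by (auto simp: c2_def hd_append)
  have l2: "length c2 = Suc i + (length c - j)" using ij by (simp add: c2_def)
  have lt: "last (take (Suc i) c) = c ! i" "hd (drop j c) = c ! j"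
    using ij by (simp_all add: take_Suc_conv_app_nth hd_drop_conv_nth)
  have "successively (\<lambda>u v. {u, v} \<in> E) c2"
    unfolding c2_def successively_append_iff lt
    using ij eE succ by (auto simp: successively_conv_nth)
  moreover have "distinct c2"
    unfolding c2_def using dist ij by (simp add: set_take_disj_set_drop_if_distinct)
  ultimately have cyc2: "is_cycle E c2"
    unfolding is_cycle_iff_successively h2 using l2 ij j2 cl by auto
  have in2: "c ! i \<in> set c2" "c ! j \<in> set c2"
    using ij by (auto simp: c2_def take_Suc_conv_app_nth Cons_nth_drop_Suc[symmetric])
  have "set c = set c1 \<union> set c2"
  proof
    show "set c1 \<union> set c2 \<subseteq> set c"
      by (auto simp: c1_def c2_def dest!: in_set_takeD in_set_dropD)
    show "set c \<subseteq> set c1 \<union> set c2"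
    proof
      fix w assume "w \<in> set c"
      then obtain k where k: "k < length c" "w = c ! k" by (auto simp: in_set_conv_nth)
      consider "k \<le> i" | "i < k" "k < j" | "j \<le> k" by linarith
      then show "w \<in> set c1 \<union> set c2"
      proof cases
        case 1
        then show ?thesis using k ij
          by (auto simp: c2_def in_set_conv_nth intro!: exI[of _ k])
      next
        case 2
        then show ?thesis using k l1 n1[of "k - i"]
          by (auto simp: in_set_conv_nth intro!: exI[of _ "k - i"])
      next
        case 3
        then have "c ! k \<in> set (drop j c)" using k
          by (auto simp: in_set_conv_nth intro!: exI[of _ "k - j"])
        then show ?thesis using k by (simp add: c2_def)
      qed
    qed
  qed
  with cyc1 cyc2 h1 h2 in2 l1 l2 ij j1 j2 show ?thesis
    by (intro that[of c1 c2]) auto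
qed

text \<open>Of the possible lengths 3, 4 and 5, the odd ones are impossible because membership in
  \<open>A\<close> alternates along edges.\<close>

lemma bipartite_short_cycle:
  assumes "simple_graph V E" "bipartite V E" "is_cycle E c" "length c < 6"
  obtains w x y z where "c = [w, x, y, z]"
proof -
  obtain A B where AB: "A \<union> B = V" "independent_set E A" "independent_set E B"
    using assms(2) by (auto simp: bipartite_def)
  have alt: "u \<in> A \<and> v \<in> B - A \<or> u \<in> B - A \<and> v \<in> A" if "{u, v} \<in> E" for u v
  proof -
    have "u \<in> A \<union> B" "v \<in> A \<union> B" using that assms(1) AB by (auto simp: simple_graph_def)
    with that AB show ?thesis by (auto simp: independent_set_def)
  qed
  have "length c = 3 \<or> length c = 4 \<or> length c = 5"
    using assms by (auto simp: is_cycle_def)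
  then show ?thesis
  proof (elim disjE)
    assume "length c = 3"
    then obtain p q r where "c = [p, q, r]" by (auto simp: numeral_eq_Suc length_Suc_conv)
    then have "{p, q} \<in> E" "{q, r} \<in> E" "{r, p} \<in> E"
      using assms(3) by (auto simp: is_cycle_iff_successively)
    then show ?thesis using alt by blast
  next
    assume "length c = 4"
    then show ?thesis using that by (auto simp: numeral_eq_Suc length_Suc_conv)
  next
    assume "length c = 5"
    then obtain p q r s t where "c = [p, q, r, s, t]"
      by (auto simp: numeral_eq_Suc length_Suc_conv)
    then have "{p, q} \<in> E" "{q, r} \<in> E" "{r, s} \<in> E" "{s, t} \<in> E" "{t, p} \<in> E"
      using assms(3) by (auto simp: is_cycle_iff_successively)
    then show ?thesis using alt by blast
  qed
qed

text \<open>Strong induction on the length. If \<open>c2\<close> leaves \<open>H\<close>, it still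
  has the closing edge of \<open>c\<close>. Otherwise \<open>c2\<close> lies in \<open>H\<close>, so
  both ends of the chord do, and the induction continues with \<open>c1\<close>, whose closing edge
  is the chord.\<close>

lemma short_cycle_leaving_set:
  assumes G: "simple_graph V E" "chordal_bipartite V E"
    and "is_cycle E c" "hd c \<in> H" "last c \<in> H" "\<not> set c \<subseteq> H"
  shows "\<exists>w x y z. is_cycle E [w, x, y, z] \<and> w \<in> H \<and> z \<in> H \<and> \<not> {x, y} \<subseteq> H"
  using assms(3-)
proof (induction "length c" arbitrary: c rule: less_induct)
  case less
  show ?case
  proof (cases "length c < 6")
    case True
    with less.prems G obtain w x y z where "c = [w, x, y, z]"
      by (meson bipartite_short_cycle chordal_bipartite_def)
    with less.prems show ?thesis by auto
  next
    case False
    then have "\<exists>e. is_chord E c e"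
      using less.prems(1) G(2) by (simp add: chordal_bipartite_def)
    then obtain e where e: "is_chord E c e" ..
    then have "card e = 2" using G by (auto simp: simple_graph_def is_chord_def)
    with less.prems(1) e obtain c1 c2 where "is_cycle E c1" "is_cycle E c2"
      "length c1 < length c" "length c2 < length c" "set c = set c1 \<union> set c2"
      "hd c2 = hd c" "last c2 = last c" "hd c1 \<in> set c2" "last c1 \<in> set c2"
      by (rule chord_splits_cycle)
    then show ?thesis using less.hyps[of c1] less.hyps[of c2] less.prems by auto
  qed
qed

section \<open>The lower bound by growing a dense induced subgraph\<close>

text \<open>Ladders attain equality: \<open>2 * k\<close> vertices and \<open>3 * k - 2\<close>
  edges. The neighbour clause provides the edge inside \<open>H\<close> that the next cycle is
  closed with.\<close>

definition has_ladder_density :: "'a set set \<Rightarrow> 'a set \<Rightarrow> bool" where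
  "has_ladder_density E H \<longleftrightarrow> finite H \<and> H \<noteq> {} \<and> (\<forall>v\<in>H. \<exists>w\<in>H. {v, w} \<in> E) \<and>
     3 * card H \<le> 2 * card {e \<in> E. e \<subseteq> H} + 4"

text \<open>Edges in \<open>F\<close> are not inside \<open>H\<close>, so they are counted in
  addition to the old ones; three edges for every two vertices preserve the inequality.\<close>

lemma has_ladder_density_extend:
  assumes H: "has_ladder_density E H" and fin: "finite E"
    and new: "N \<inter> H = {}" "finite N" "\<And>v. v \<in> N \<Longrightarrow> \<exists>w\<in>H \<union> N. {v, w} \<in> E"
    and F: "F \<subseteq> E" "\<And>e. e \<in> F \<Longrightarrow> e \<subseteq> H \<union> N \<and> \<not> e \<subseteq> H"
    and card: "3 * card N \<le> 2 * card F"
  shows "has_ladder_density E (H \<union> N)"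
proof -
  have "card {e \<in> E. e \<subseteq> H} + card F = card ({e \<in> E. e \<subseteq> H} \<union> F)"
    using F fin by (intro card_Un_disjoint[symmetric]) (auto intro: finite_subset)
  also have "\<dots> \<le> card {e \<in> E. e \<subseteq> H \<union> N}"
    using F fin by (intro card_mono) auto
  moreover have "card (H \<union> N) = card H + card N"
    using H new by (intro card_Un_disjoint) (auto simp: has_ladder_density_def)
  ultimately have "3 * card (H \<union> N) \<le> 2 * card {e \<in> E. e \<subseteq> H \<union> N} + 4"
    using H card by (simp add: has_ladder_density_def)
  moreover have "\<exists>w\<in>H \<union> N. {v, w} \<in> E" if "v \<in> H \<union> N" for v
    using that H new(3)[of v] by (auto simp: has_ladder_density_def)
  ultimately show ?thesis
    using H new by (simp add: has_ladder_density_def)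
qed

lemma chordal_bipartite_density_step:
  assumes G: "simple_graph V E" "chordal_bipartite V E" "graph_connected V E"
      "\<And>s. s \<in> V \<Longrightarrow> graph_connected (V - {s}) {e \<in> E. s \<notin> e}"
    and H: "has_ladder_density E H" "H \<subset> V"
  shows "\<exists>H'. H \<subset> H' \<and> H' \<subseteq> V \<and> has_ladder_density E H'"
proof -
  have edge: "u \<in> V \<and> v \<in> V \<and> u \<noteq> v" if "{u, v} \<in> E" for u v
    using G(1) that by (fastforce simp: simple_graph_def)
  have finE: "finite E"
    using G(1) by (auto simp: simple_graph_def intro: finite_subset[of E "Pow V"])
  \<comment> \<open>On a path from a vertex of \<open>H\<close> to one outside, some edge leaves
    \<open>H\<close>.\<close>
  obtain a x where ax: "a \<in> H" "x \<notin> H" "{a, x} \<in> E"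
  proof -
    obtain h v where hv: "h \<in> H" "v \<in> V" "v \<notin> H" using H by (auto simp: has_ladder_density_def)
    then have "(\<lambda>x y. {x, y} \<in> E)\<^sup>*\<^sup>* h v" using G(3) H(2) by (auto simp: graph_connected_def)
    then have "v \<in> H \<or> (\<exists>a x. a \<in> H \<and> x \<notin> H \<and> {a, x} \<in> E)"
      by (induction rule: rtranclp_induct) (use hv in auto)
    with hv that show ?thesis by blast
  qed
  obtain b where b: "b \<in> H" "{a, b} \<in> E" using H(1) ax(1) by (auto simp: has_ladder_density_def)
  have "a \<noteq> b" "a \<noteq> x" "x \<noteq> b" "a \<in> V" "b \<in> V" "x \<in> V" using edge ax b by auto
  then obtain c where "is_cycle E c" "hd c = a" "last c = b" "x \<in> set c"
    using cycle_through_adjacent_edges[OF G(4)] ax b by metis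
  then have "\<exists>w x y z. is_cycle E [w, x, y, z] \<and> w \<in> H \<and> z \<in> H \<and> \<not> {x, y} \<subseteq> H"
    using ax b by (intro short_cycle_leaving_set[OF G(1,2)]) auto
  then obtain w x y z where q: "is_cycle E [w, x, y, z]" "w \<in> H" "z \<in> H" "\<not> {x, y} \<subseteq> H"
    by blast
  have d: "distinct [w, x, y, z]" and e: "{w, x} \<in> E" "{x, y} \<in> E" "{y, z} \<in> E"
    using q(1) by (auto simp: is_cycle_iff_successively)
  have inV: "x \<in> V" "y \<in> V" using e edge by auto
  \<comment> \<open>The edge between \<open>z\<close> and \<open>w\<close> lies inside
    \<open>H\<close>. A single new vertex brings its two edges on the square, two new vertices bring
    the other three edges.\<close>
  consider "x \<in> H" "y \<notin> H" | "x \<notin> H" "y \<in> H" | "x \<notin> H" "y \<notin> H" using q(4) by auto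
  then show ?thesis
  proof cases
    case 1
    have "{x, y} \<noteq> {y, z}" using d by (auto simp: doubleton_eq_iff)
    then have "has_ladder_density E (H \<union> {y})"
      using 1 e q by (intro has_ladder_density_extend[OF H(1) finE, where F = "{{x, y}, {y, z}}"]) auto
    with 1 inV H(2) show ?thesis by (intro exI[of _ "H \<union> {y}"]) auto
  next
    case 2
    have "{w, x} \<noteq> {x, y}" using d by (auto simp: doubleton_eq_iff)
    then have "has_ladder_density E (H \<union> {x})"
      using 2 e q by (intro has_ladder_density_extend[OF H(1) finE, where F = "{{w, x}, {x, y}}"]) auto
    with 2 inV H(2) show ?thesis by (intro exI[of _ "H \<union> {x}"]) auto
  next
    case 3
    have "{w, x} \<noteq> {x, y}" "{w, x} \<noteq> {y, z}" "{x, y} \<noteq> {y, z}"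
      using d by (auto simp: doubleton_eq_iff)
    then have "has_ladder_density E (H \<union> {x, y})"
      using 3 e q d
      by (intro has_ladder_density_extend[OF H(1) finE, where F = "{{w, x}, {x, y}, {y, z}}"])
        (auto simp: insert_commute)
    with 3 inV H(2) show ?thesis by (intro exI[of _ "H \<union> {x, y}"]) auto
  qed
qed

lemma chordal_bipartite_size_lower_bound:
  assumes G: "simple_graph V E" "k_connected 2 V E" "chordal_bipartite V E" and n: "card V \<ge> 4"
  shows "3 * card V \<le> 2 * card E + 4"
proof -
  have conn: "graph_connected V E" "\<And>s. s \<in> V \<Longrightarrow> graph_connected (V - {s}) {e \<in> E. s \<notin> e}"
    using k_connected_2_iff[OF G(1)] G(2) n by auto
  have fin: "finite V" and edges: "\<And>e. e \<in> E \<Longrightarrow> e \<subseteq> V \<and> card e = 2"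
    using G(1) by (auto simp: simple_graph_def)
  have "\<not> card V \<le> Suc 0" using n by simp
  then obtain u v where uv: "u \<in> V" "v \<in> V" "u \<noteq> v"
    using card_le_Suc0_iff_eq[OF fin] by blast
  then have "(\<lambda>x y. {x, y} \<in> E)\<^sup>*\<^sup>* u v" using conn(1) by (auto simp: graph_connected_def)
  then obtain w where w: "{u, w} \<in> E"
    by (rule converse_rtranclpE) (use uv(3) in auto)
  \<comment> \<open>One edge suffices for two vertices: \<open>3 * 2 = 2 * 1 + 4\<close>.\<close>
  have "card {{u, w}} \<le> card {e \<in> E. e \<subseteq> {u, w}}"
    using w finite_subset[of "{e \<in> E. e \<subseteq> {u, w}}" "Pow {u, w}"] by (intro card_mono) auto
  moreover have "card {u, w} = 2" "{u, w} \<subseteq> V" using edges w by auto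
  ultimately have start: "has_ladder_density E {u, w}" "{u, w} \<subseteq> V"
    using w by (auto simp: has_ladder_density_def insert_commute)
  \<comment> \<open>A maximal dense set above the starting edge; the density step then forces it to
    be all of \<open>V\<close>.\<close>
  obtain H where H: "has_ladder_density E H" "H \<subseteq> V"
      "\<And>H'. has_ladder_density E H' \<Longrightarrow> H' \<subseteq> V \<Longrightarrow> \<not> H \<subset> H'"
  proof -
    define D where "D = {H. has_ladder_density E H \<and> H \<subseteq> V}"
    have "finite D"
      using fin by (auto simp: D_def intro: finite_subset[of _ "Pow V"])
    moreover have "{u, w} \<in> D" using start by (simp add: D_def)
    ultimately have "\<exists>H\<in>D. {u, w} \<subseteq> H \<and> (\<forall>H'\<in>D. H \<subseteq> H' \<longrightarrow> H = H')"
      by (rule finite_has_maximal2)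
    then obtain H where "H \<in> D" and max: "\<And>H'. H' \<in> D \<Longrightarrow> H \<subseteq> H' \<Longrightarrow> H = H'" by metis
    then have H: "has_ladder_density E H" "H \<subseteq> V" by (simp_all add: D_def)
    have "\<not> H \<subset> H'" if "has_ladder_density E H'" "H' \<subseteq> V" for H'
      using max[of H'] that by (auto simp: D_def)
    then show ?thesis by (rule that[OF H])
  qed
  have "\<not> H \<subset> V"
  proof
    assume "H \<subset> V"
    from chordal_bipartite_density_step[OF G(1,3) conn H(1) this] H(3) show False by metis
  qed
  with H(2) have "H = V" by blast
  moreover have "{e \<in> E. e \<subseteq> V} = E" using edges by auto
  ultimately show ?thesis using H(1) by (simp add: has_ladder_density_def)
qed

section \<open>Tightness: chords of cycles through an ear, and gluing squares\<close>

text \<open>The edges are the pairs in \<open>zip c (rotate1 c)\<close>, and rotating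
  \<open>c\<close> rotates this list of pairs. Hence any vertex of a cycle may be moved to position
  0.\<close>

lemma cycle_edges_rotate: "cycle_edges (rotate k c) = cycle_edges c"
proof -
  have zip: "cycle_edges c = (\<lambda>(u, v). {u, v}) ` set (zip c (rotate1 c))" for c :: "'a list"
    unfolding cycle_edges_def set_zip by (force simp: nth_rotate1)
  have "zip (rotate k c) (rotate1 (rotate k c)) = rotate k (zip c (rotate1 c))"
  proof (rule nth_equalityI)
    fix i assume "i < length (zip (rotate k c) (rotate1 (rotate k c)))"
    then have i: "i < length c" by simp
    then have c: "c \<noteq> []" by auto
    have "rotate1 (rotate k c) = rotate k (rotate1 c)"
      by (simp add: rotate1_rotate_swap)
    then show "zip (rotate k c) (rotate1 (rotate k c)) ! i = rotate k (zip c (rotate1 c)) ! i"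
      using i c by (simp add: nth_rotate)
  qed simp
  then show ?thesis unfolding zip by simp
qed

lemma is_cycle_rotate: "is_cycle E (rotate k c) \<longleftrightarrow> is_cycle E c"
  by (simp add: is_cycle_def cycle_edges_rotate)

lemma is_chord_rotate: "is_chord E (rotate k c) e \<longleftrightarrow> is_chord E c e"
  by (simp add: is_chord_def cycle_edges_rotate)

lemma doubleton_in_cycle_edges_iff:
  assumes "distinct c" "i < j" "j < length c"
  shows "{c ! i, c ! j} \<in> cycle_edges c \<longleftrightarrow> j = Suc i \<or> i = 0 \<and> Suc j = length c"
proof
  assume "{c ! i, c ! j} \<in> cycle_edges c"
  then obtain k where k: "k < length c" "{c ! i, c ! j} = {c ! k, c ! (Suc k mod length c)}"
    by (auto simp: cycle_edges_def)
  have m: "Suc k mod length c < length c" using k by (intro mod_less_divisor) auto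
  have "i = k \<and> j = Suc k mod length c \<or> i = Suc k mod length c \<and> j = k"
    using k m assms by (auto simp: doubleton_eq_iff nth_eq_iff_index_eq)
  then show "j = Suc i \<or> i = 0 \<and> Suc j = length c"
    using k assms by (auto simp: mod_Suc split: if_splits)
next
  assume "j = Suc i \<or> i = 0 \<and> Suc j = length c"
  then show "{c ! i, c ! j} \<in> cycle_edges c"
  proof
    assume "j = Suc i"
    with assms show ?thesis unfolding cycle_edges_def by (auto intro!: exI[of _ i])
  next
    assume "i = 0 \<and> Suc j = length c"
    with assms show ?thesis
      unfolding cycle_edges_def by (auto simp: insert_commute intro!: exI[of _ j])
  qed
qed

text \<open>Since \<open>x\<close> and \<open>y\<close> have no neighbours off the path
  \<open>a\<close>, \<open>x\<close>, \<open>y\<close>, \<open>b\<close>, a cycle through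
  \<open>x\<close> traverses this whole path. Its length then keeps \<open>a\<close> and
  \<open>b\<close> from being neighbours on it.\<close>

lemma chord_of_cycle_through_ear:
  assumes c: "is_cycle F c" "length c \<ge> 6" and x: "x \<in> set c"
    and nx: "\<And>w. {x, w} \<in> F \<Longrightarrow> w = a \<or> w = y" and ny: "\<And>w. {y, w} \<in> F \<Longrightarrow> w = b \<or> w = x"
    and ab: "{a, b} \<in> F" and "x \<noteq> y"
  shows "is_chord F c {a, b}"
proof -
  obtain k where k: "k < length c" "c ! k = x" using x by (auto simp: in_set_conv_nth)
  define d where "d = rotate k c"
  have d: "is_cycle F d" "length d \<ge> 6" using c by (auto simp: d_def is_cycle_rotate)
  define L where "L = length d"
  have L: "L \<ge> 6" using d by (simp add: L_def)
  have d0: "d ! 0 = x" using nth_rotate[of 0 c k] k by (cases "c = []") (auto simp: d_def)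
  have ne: "d \<noteq> []" using d by auto
  have dist: "distinct d" and succ: "\<And>i. Suc i < L \<Longrightarrow> {d ! i, d ! Suc i} \<in> F"
    and cl: "{d ! (L - 1), d ! 0} \<in> F"
    using d ne by (auto simp: is_cycle_iff_successively successively_conv_nth last_conv_nth
        hd_conv_nth L_def)
  have eq: "d ! i = d ! j \<longleftrightarrow> i = j" if "i < L" "j < L" for i j
    using that dist by (simp add: L_def nth_eq_iff_index_eq)
  have one: "d ! 1 = a \<or> d ! 1 = y" using nx succ[of 0] d0 L by simp
  have lst: "d ! (L - 1) = a \<or> d ! (L - 1) = y" using nx cl d0 by (simp add: insert_commute)
  have "d ! 1 \<noteq> d ! (L - 1)" using eq[of 1 "L - 1"] L by simp
  \<comment> \<open>The two directions in which the cycle can run through the ear.\<close>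
  with one lst consider "d ! 1 = y" "d ! (L - 1) = a" | "d ! 1 = a" "d ! (L - 1) = y" by metis
  then have "is_chord F d {a, b}"
  proof cases
    case 1
    have "d ! 2 = b \<or> d ! 2 = x" using ny succ[of 1] 1 L by (simp add: numeral_2_eq_2)
    then have b: "d ! 2 = b" using eq[of 2 0] d0 L by auto
    have "{d ! 2, d ! (L - 1)} \<notin> cycle_edges d"
      using L dist by (subst doubleton_in_cycle_edges_iff) (auto simp: L_def)
    moreover have "d ! 2 \<in> set d" "d ! (L - 1) \<in> set d" using L by (auto simp: L_def)
    ultimately show ?thesis using b 1 ab by (auto simp: is_chord_def insert_commute)
  next
    case 2
    have "{d ! (L - 2), d ! (L - 1)} \<in> F" 
      using succ[of "L - 2"] L by (simp add: Suc_diff_Suc numeral_2_eq_2)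
    then have "d ! (L - 2) = b \<or> d ! (L - 2) = x" using ny 2 by (simp add: insert_commute)
    then have b: "d ! (L - 2) = b" using eq[of "L - 2" 0] d0 L by auto
    have "{d ! 1, d ! (L - 2)} \<notin> cycle_edges d"
      using L dist by (subst doubleton_in_cycle_edges_iff) (auto simp: L_def)
    moreover have "d ! 1 \<in> set d" "d ! (L - 2) \<in> set d" using L by (auto simp: L_def)
    ultimately show ?thesis using b 2 ab by (auto simp: is_chord_def)
  qed
  then show ?thesis by (simp add: d_def is_chord_rotate)
qed

text \<open>As \<open>s\<close> ranges over the whole type and \<open>V\<close> is finite, the connectedness of the graph
  itself is included.\<close>

definition tight_graph :: "nat set \<Rightarrow> nat set set \<Rightarrow> bool" where
  "tight_graph V E \<longleftrightarrow> simple_graph V E \<and> chordal_bipartite V E \<and> {0, 1} \<in> E \<and>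
     (\<forall>s. graph_connected (V - {s}) {e \<in> E. s \<notin> e})"

text \<open>\<open>W\<close> serves as a hub: two vertices are joined through it, the second path
  being reversed by symmetry of adjacency.\<close>

lemma graph_connected_via:
  assumes "W \<subseteq> U" and W: "\<And>u v. u \<in> W \<Longrightarrow> v \<in> W \<Longrightarrow> (\<lambda>x y. {x, y} \<in> E)\<^sup>*\<^sup>* u v"
    and reach: "\<And>u. u \<in> U \<Longrightarrow> \<exists>w\<in>W. (\<lambda>x y. {x, y} \<in> E)\<^sup>*\<^sup>* u w"
  shows "graph_connected U E"
  unfolding graph_connected_def
proof (intro ballI)
  fix u v assume "u \<in> U" "v \<in> U"
  then obtain w w' where w: "w \<in> W" "(\<lambda>x y. {x, y} \<in> E)\<^sup>*\<^sup>* u w"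
      "w' \<in> W" "(\<lambda>x y. {x, y} \<in> E)\<^sup>*\<^sup>* v w'" using reach by meson
  have "symp (\<lambda>x y. {x, y} \<in> E)" by (auto intro: sympI simp: insert_commute)
  then have "(\<lambda>x y. {x, y} \<in> E)\<^sup>*\<^sup>* w' v" using w(4) by (metis sympD symp_rtranclp)
  with w W[of w w'] show "(\<lambda>x y. {x, y} \<in> E)\<^sup>*\<^sup>* u v" by (meson rtranclp_trans)
qed

text \<open>The path \<open>0\<close>, \<open>x\<close>, \<open>y\<close>, \<open>1\<close> is an
  ear on the edge \<open>{0, 1}\<close>. A long cycle meeting the ear has \<open>{0, 1}\<close> as a
  chord, and any other cycle already lives in \<open>E\<close>. The edge \<open>{0, 1}\<close>
  survives for the next gluing.\<close>

lemma tight_graph_add_square: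
  assumes T: "tight_graph V E" and new: "x \<notin> V" "y \<notin> V" "x \<noteq> y"
  defines "E' \<equiv> E \<union> {{0, x}, {x, y}, {y, 1}}"
  shows "tight_graph (V \<union> {x, y}) E'" "card E' = card E + 3"
proof -
  have simple: "simple_graph V E" and cb: "chordal_bipartite V E" and e01: "{0, 1} \<in> E"
    and conn: "\<And>s. graph_connected (V - {s}) {e \<in> E. s \<notin> e}"
    using T by (auto simp: tight_graph_def)
  have edges: "\<And>e. e \<in> E \<Longrightarrow> e \<subseteq> V \<and> card e = 2" and fin: "finite V"
    using simple by (auto simp: simple_graph_def)
  have V01: "0 \<in> V" "1 \<in> V" using edges[OF e01] by auto
  have ne: "x \<noteq> 0" "x \<noteq> 1" "y \<noteq> 0" "y \<noteq> 1" using V01 new by metis+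
  have old: "{x, w} \<notin> E" "{w, x} \<notin> E" "{y, w} \<notin> E" "{w, y} \<notin> E" for w using edges new by auto
  have finE: "finite E" using fin edges by (auto intro: finite_subset[of E "Pow V"])
  have "{{0, x}, {x, y}, {y, 1}} \<inter> E = {}" using old by auto
  moreover have "card {{0, x}, {x, y}, {y, 1}} = 3"
    using ne new by (auto simp: doubleton_eq_iff card_insert_if)
  ultimately show "card E' = card E + 3"
    unfolding E'_def using finE by (subst card_Un_disjoint) auto
  have "simple_graph (V \<union> {x, y}) E'"
    using edges fin V01 ne new by (auto simp: simple_graph_def E'_def card_insert_if)
  moreover have "bipartite (V \<union> {x, y}) E'"
  proof -
    obtain A B where AB: "A \<union> B = V" "A \<inter> B = {}" "independent_set E A" "independent_set E B"
      using cb by (auto simp: chordal_bipartite_def bipartite_def)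
    \<comment> \<open>The class of \<open>0\<close> receives \<open>y\<close> and that of
      \<open>1\<close> receives \<open>x\<close>; the classes are named so that \<open>0\<close>
      lies in \<open>A\<close>.\<close>
    have *: "bipartite (V \<union> {x, y}) E'"
      if h: "A \<union> B = V" "A \<inter> B = {}" "independent_set E A" "independent_set E B" "0 \<in> A" for A B
    proof -
      have 1: "1 \<in> B" "0 \<notin> B" "1 \<notin> A" using h e01 V01 by (auto simp: independent_set_def)
      have xy: "x \<notin> A" "x \<notin> B" "y \<notin> A" "y \<notin> B" using h new by auto
      have "independent_set E' (insert y A)" "independent_set E' (insert x B)"
        using h 1 ne new xy old unfolding independent_set_def E'_def
        by (auto simp: doubleton_eq_iff)
      then show ?thesis using h new unfolding bipartite_def
        by (intro exI[of _ "insert y A"] exI[of _ "insert x B"]) auto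
    qed
    show ?thesis
    proof (cases "0 \<in> A")
      case True
      then show ?thesis using *[of A B] AB by blast
    next
      case False
      then have "0 \<in> B" using AB V01 by auto
      then show ?thesis using *[of B A] AB by blast
    qed
  qed
  moreover have "\<exists>e. is_chord E' c e" if c: "is_cycle E' c" "length c \<ge> 6" for c
  proof -
    have N: "{x, w} \<in> E' \<Longrightarrow> w = 0 \<or> w = y" "{y, w} \<in> E' \<Longrightarrow> w = 1 \<or> w = x" for w
      using old new by (auto simp: E'_def doubleton_eq_iff)
    have e: "{0, 1} \<in> E'" using e01 by (simp add: E'_def)
    consider "x \<in> set c" | "y \<in> set c" | "x \<notin> set c" "y \<notin> set c" by blast
    then show ?thesis
    proof cases
      case 1
      then show ?thesis using chord_of_cycle_through_ear[OF c 1 N e] new by blast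
    next
      case 2
      \<comment> \<open>The same ear read from its other end, with the roles of \<open>0\<close> and
        \<open>1\<close> exchanged.\<close>
      then show ?thesis
        using chord_of_cycle_through_ear[OF c 2 N(2) N(1)] e new by (auto simp: insert_commute)
    next
      case 3
      have "f \<in> E" if f: "f \<in> cycle_edges c" for f
      proof -
        from f obtain i where i: "i < length c" "f = {c ! i, c ! (Suc i mod length c)}"
          by (auto simp: cycle_edges_def)
        then have "Suc i mod length c < length c" by (intro mod_less_divisor) auto
        with i have "f \<subseteq> set c" by auto
        moreover have "f \<in> E'" using f c by (auto simp: is_cycle_def)
        ultimately show ?thesis using 3 by (auto simp: E'_def)
      qed
      then have "is_cycle E c" using c by (auto simp: is_cycle_def)
      then obtain e where "is_chord E c e" using cb c by (auto simp: chordal_bipartite_def)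
      then show ?thesis by (auto simp: is_chord_def E'_def)
    qed
  qed
  moreover have "graph_connected (V \<union> {x, y} - {s}) {e \<in> E'. s \<notin> e}" for s
  proof (rule graph_connected_via[of "V - {s}"])
    let ?R = "\<lambda>u v. {u, v} \<in> {e \<in> E'. s \<notin> e}"
    fix u v assume "u \<in> V - {s}" "v \<in> V - {s}"
    then have "(\<lambda>u v. {u, v} \<in> {e \<in> E. s \<notin> e})\<^sup>*\<^sup>* u v"
      using conn[of s] by (simp add: graph_connected_def)
    then show "?R\<^sup>*\<^sup>* u v" by (rule rtranclp_mono[THEN predicate2D, rotated]) (auto simp: E'_def)
  next
    let ?R = "\<lambda>u v. {u, v} \<in> {e \<in> E'. s \<notin> e}"
    have R: "s \<noteq> x \<Longrightarrow> s \<noteq> 0 \<Longrightarrow> ?R x 0" "s \<noteq> y \<Longrightarrow> s \<noteq> 1 \<Longrightarrow> ?R y 1"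
      "s \<noteq> x \<Longrightarrow> s \<noteq> y \<Longrightarrow> ?R x y" "s \<noteq> x \<Longrightarrow> s \<noteq> y \<Longrightarrow> ?R y x"
      by (auto simp: E'_def insert_commute)
    \<comment> \<open>\<open>x\<close> reaches \<open>0\<close> directly, or \<open>1\<close>
      through \<open>y\<close> if \<open>0\<close> is the deleted vertex; \<open>hy\<close> is the
      mirror image.\<close>
    have hx: "\<exists>w\<in>V - {s}. ?R\<^sup>*\<^sup>* x w" if "s \<noteq> x"
    proof (cases "s = 0")
      case True
      then have "?R x y" "?R y 1" using R that ne by auto
      then have "?R\<^sup>*\<^sup>* x 1" by (meson rtranclp.rtrancl_into_rtrancl rtranclp.rtrancl_refl)
      then show ?thesis using True V01 by (intro bexI[of _ 1]) auto
    next
      case False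
      then show ?thesis using R(1) that V01 by (intro bexI[of _ 0]) auto
    qed
    have hy: "\<exists>w\<in>V - {s}. ?R\<^sup>*\<^sup>* y w" if "s \<noteq> y"
    proof (cases "s = 1")
      case True
      then have "?R y x" "?R x 0" using R that ne by auto
      then have "?R\<^sup>*\<^sup>* y 0" by (meson rtranclp.rtrancl_into_rtrancl rtranclp.rtrancl_refl)
      then show ?thesis using True V01 by (intro bexI[of _ 0]) auto
    next
      case False
      then show ?thesis using R(2) that V01 by (intro bexI[of _ 1]) auto
    qed
    fix u assume "u \<in> V \<union> {x, y} - {s}"
    then consider "u \<in> V - {s}" | "u = x" "s \<noteq> x" | "u = y" "s \<noteq> y" by auto
    then show "\<exists>w\<in>V - {s}. ?R\<^sup>*\<^sup>* u w"
      by cases (use hx hy in auto)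
  qed auto
  ultimately show "tight_graph (V \<union> {x, y}) E'"
    using e01 by (auto simp: tight_graph_def chordal_bipartite_def E'_def)
qed

lemma cycle_length_le_card:
  assumes "simple_graph V E" "is_cycle E c"
  shows "length c \<le> card V"
proof -
  have "v \<in> V" if "v \<in> set c" for v
  proof -
    obtain i where i: "i < length c" "c ! i = v" using \<open>v \<in> set c\<close> by (auto simp: in_set_conv_nth)
    then have "{v, c ! (Suc i mod length c)} \<in> E"
      using assms(2) by (auto simp: cycle_edges_def is_cycle_def)
    with assms(1) show ?thesis unfolding simple_graph_def by blast
  qed
  then have "card (set c) \<le> card V"
    using assms by (intro card_mono) (auto simp: simple_graph_def)
  then show ?thesis using assms by (simp add: is_cycle_def distinct_card)
qed

text \<open>With fewer than six vertices the chord condition is vacuous; this settles both base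
  graphs.\<close>

lemma chordal_bipartite_if_card_less_6:
  assumes "simple_graph V E" "bipartite V E" "card V < 6"
  shows "chordal_bipartite V E"
proof -
  have "length c < 6" if "is_cycle E c" for c
    using cycle_length_le_card[OF assms(1) that] assms(3) by linarith
  then show ?thesis using assms(2) by (auto simp: chordal_bipartite_def not_le[symmetric])
qed

lemma tight_graph_K2: "tight_graph {0, 1} {{0, 1}}"
proof -
  have s: "simple_graph {0, 1::nat} {{0, 1}}" by (auto simp: simple_graph_def)
  have "bipartite {0, 1::nat} {{0, 1}}"
    unfolding bipartite_def independent_set_def
    by (intro exI[of _ "{0}"] exI[of _ "{1}"]) auto
  moreover have "graph_connected ({0, 1::nat} - {s}) {e \<in> {{0, 1}}. s \<notin> e}" for s
    \<comment> \<open>The hub is one surviving vertex: \<open>1\<close> if \<open>0\<close> is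
      deleted, else \<open>0\<close>.\<close>
    by (rule graph_connected_via[of "{if s = 0 then 1 else 0} - {s}"])
      (auto simp: insert_commute intro: r_into_rtranclp split: if_splits)
  ultimately show ?thesis
    using s chordal_bipartite_if_card_less_6[OF s] by (simp add: tight_graph_def)
qed

lemma tight_graph_K23:
  "tight_graph {0, 1, 2, 3, 4} {{0, 1}, {0, 2}, {0, 3}, {4, 1}, {4, 2}, {4, 3}}"
    (is "tight_graph ?V ?E")
proof -
  have s: "simple_graph ?V ?E" by (auto simp: simple_graph_def)
  have "bipartite ?V ?E"
    unfolding bipartite_def independent_set_def
    by (intro exI[of _ "{0, 4}"] exI[of _ "{1, 2, 3}"]) (auto simp: doubleton_eq_iff)
  moreover have "graph_connected (?V - {s}) {e \<in> ?E. s \<notin> e}" for s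
  proof -
    let ?R = "\<lambda>u v. {u, v} \<in> {e \<in> ?E. s \<notin> e}"
    \<comment> \<open>One survivor on each side: \<open>p\<close> is the hub, and vertices on its
      own side reach it through \<open>q\<close>.\<close>
    obtain p where p: "p \<in> {0, 4}" "p \<noteq> s" using that[of 0] that[of 4] by (cases "s = 0") auto
    obtain q where q: "q \<in> {1, 2, 3}" "q \<noteq> s" using that[of 1] that[of 2] by (cases "s = 1") auto
    have R: "?R u v" if "u \<in> {0, 4}" "v \<in> {1, 2, 3}" "u \<noteq> s" "v \<noteq> s" for u v
    proof -
      have "{u, v} \<in> ?E" using that(1,2) by (elim insertE emptyE) simp_all
      with that(3,4) show ?thesis by simp
    qed
    have R': "?R v u" if "u \<in> {0, 4}" "v \<in> {1, 2, 3}" "u \<noteq> s" "v \<noteq> s" for u v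
      using R[OF that] by (subst insert_commute)
    show ?thesis
    proof (rule graph_connected_via[of "{p}"])
      fix u assume "u \<in> ?V - {s}"
      then consider "u \<in> {1, 2, 3}" "u \<noteq> s" | "u \<in> {0, 4}" "u \<noteq> s" by auto
      then have "?R\<^sup>*\<^sup>* u p"
      proof cases
        case 1
        then show ?thesis using R' p by blast
      next
        case 2
        have "?R u q" "?R q p"
          by (rule R[OF 2(1) q(1) 2(2) q(2)], rule R'[OF p(1) q(1) p(2) q(2)])
        then show ?thesis by (meson rtranclp.rtrancl_into_rtrancl rtranclp.rtrancl_refl)
      qed
      then show "\<exists>w\<in>{p}. ?R\<^sup>*\<^sup>* u w" by blast
    qed (use p in auto)
  qed
  ultimately show ?thesis
    using s chordal_bipartite_if_card_less_6[OF s] by (simp add: tight_graph_def)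
qed

section \<open>Extremal graphs of every order, and the final bounds\<close>

lemma tight_graph_exists:
  assumes "n = 2 \<or> n \<ge> 4"
  shows "\<exists>V E. tight_graph V E \<and> card V = n \<and> 2 * card E + 4 = 3 * n + n mod 2"
  using assms
proof (induction n rule: less_induct)
  case (less n)
  \<comment> \<open>Order 5 is a base case because \<open>n - 2\<close> would be 3, outside the
    range of the induction.\<close>
  consider "n = 2" | "n = 5" | "n - 2 = 2 \<or> n - 2 \<ge> 4" "n \<ge> 4" using less.prems by linarith
  then show ?case
  proof cases
    case 1
    then show ?thesis using tight_graph_K2 by (intro exI[of _ "{0, 1}"] exI[of _ "{{0, 1}}"]) simp
  next
    case 2
    have "card {{0, 1}, {0, 2}, {0, 3}, {4, 1}, {4, 2}, {4, 3::nat}} = 6"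
      by (simp add: card_insert_if doubleton_eq_iff)
    with 2 tight_graph_K23 show ?thesis by (intro exI conjI) (assumption, simp_all)
  next
    case 3
    then obtain V E where VE: "tight_graph V E" "card V = n - 2"
        "2 * card E + 4 = 3 * (n - 2) + (n - 2) mod 2"
      using less.IH[of "n - 2"] by auto
    have fin: "finite V" using VE by (simp add: tight_graph_def simple_graph_def)
    obtain x where x: "x \<notin> V" using fin ex_new_if_finite infinite_UNIV_nat by blast
    obtain y where y: "y \<notin> insert x V" using fin ex_new_if_finite infinite_UNIV_nat
      by (metis finite_insert)
    let ?E = "E \<union> {{0, x}, {x, y}, {y, 1}}"
    \<comment> \<open>Both sides of the size equation grow by 6, and the parity of the order stays
      the same.\<close>
    have "tight_graph (V \<union> {x, y}) ?E" "card ?E = card E + 3"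
      using tight_graph_add_square[OF VE(1)] x y by auto
    moreover have "card (V \<union> {x, y}) = n"
      using fin x y VE(2) 3 by (simp add: card_insert_if)
    moreover have "n mod 2 = (n - 2) mod 2" using 3(2) by (intro le_mod_geq) simp
    ultimately show ?thesis using VE(3) 3 by (intro exI conjI) (assumption, simp_all)
  qed
qed

text \<open>For odd \<open>n\<close> the left side \<open>3 * n\<close> is odd and the right side
  even, so the inequality sharpens by one; this is the extra half in the odd bound.\<close>

lemma size_bound_le_iff:
  "size_bound n \<le> real m \<longleftrightarrow> 3 * n \<le> 2 * m + 4"
proof -
  have "3 * n \<le> 2 * m + 4 \<longleftrightarrow> (if odd n then 3 * n \<le> 2 * m + 3 else 3 * n \<le> 2 * m + 4)"
    by presburger
  moreover have "size_bound n \<le> real m \<longleftrightarrow>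
      (if odd n then real (3 * n) \<le> real (2 * m + 3) else real (3 * n) \<le> real (2 * m + 4))"
    by (auto simp: size_bound_def)
  ultimately show ?thesis by (simp only: of_nat_le_iff)
qed

lemma tight_graph_k_connected_2:
  assumes "tight_graph V E" "card V \<ge> 4"
  shows "k_connected 2 V E"
proof -
  have s: "simple_graph V E" "\<And>s. graph_connected (V - {s}) {e \<in> E. s \<notin> e}"
    using assms(1) by (auto simp: tight_graph_def)
  have fin: "finite V" "\<And>e. e \<in> E \<Longrightarrow> e \<subseteq> V" using s(1) by (auto simp: simple_graph_def)
  then obtain s where "s \<notin> V" using ex_new_if_finite infinite_UNIV_nat by blast
  then have "V - {s} = V" "{e \<in> E. s \<notin> e} = E" using fin by auto
  then have "graph_connected V E" using s(2)[of s] by simp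
  then show ?thesis using k_connected_2_iff[OF s(1)] s(2) assms(2) by simp
qed

theorem theorem1p1:
  shows "(\<forall>(V :: 'a set) E.
            simple_graph V E \<and> k_connected 2 V E \<and> chordal_bipartite V E \<and> card V \<ge> 4
            \<longrightarrow> real (card E) \<ge> size_bound (card V)) \<and>
         (\<forall>n\<ge>4. \<exists>(V :: nat set) E.
            simple_graph V E \<and> k_connected 2 V E \<and> chordal_bipartite V E \<and> card V = n
            \<and> real (card E) = size_bound n)"
proof (intro conjI allI impI)
  fix V :: "'a set" and E
  assume "simple_graph V E \<and> k_connected 2 V E \<and> chordal_bipartite V E \<and> card V \<ge> 4"
  then show "real (card E) \<ge> size_bound (card V)"
    using chordal_bipartite_size_lower_bound by (auto simp: size_bound_le_iff)
next
  fix n :: nat assume n: "n \<ge> 4"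
  then obtain V E where VE: "tight_graph V E" "card V = n" "2 * card E + 4 = 3 * n + n mod 2"
    using tight_graph_exists by blast
  have "2 * real (card E) + 4 = 3 * real n + real (n mod 2)"
    using arg_cong[OF VE(3), of real] by simp
  then have "real (card E) = size_bound n"
    by (cases "odd n") (auto simp: size_bound_def odd_iff_mod_2_eq_one)
  moreover have "k_connected 2 V E" using tight_graph_k_connected_2 VE n by simp
  ultimately show "\<exists>(V :: nat set) E.
      simple_graph V E \<and> k_connected 2 V E \<and> chordal_bipartite V E \<and> card V = n
      \<and> real (card E) = size_bound n"
    using VE by (auto simp: tight_graph_def)
qed

end
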